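(* Let $G=\langle V\cup\{s\},E\rangle$ be a weighted undirected graph with source $s$, edge costs $c_{(i,j)}\ge 0$, and budgets $B_i>0$ for $i\in V$. The saving-based cost sharing mechanism (SCSM) $(g,f,x)$ satisfies cost monotonicity: for every report profile $\theta'\in\Theta$, every $i\in g(\theta')$ and every edge $(i,j)\in\theta_i'$, if the cost of $(i,j)$ is increased (all other edge costs, the budgets and the report profile $\theta'$ being unchanged) and $i$ is still selected, then $$x_i(\theta')\le x_i^+(\theta'),$$ where $x_i(\theta')$ is the cost share of $i$ with the original costs and $x_i^+(\theta')$ is its cost share with the increased cost.
   Context: Setting. $G=\langle V\cup\{s\},E\rangle$ is a finite weighted undirected graph; $s$ is the source, each edge $(i,j)\in E$ has cost $c_{(i,j)}\ge 0$, and each node $i\in V$ has a public budget $B_i>0$. For $i\in V\cup\{s\}$, $\Theta_i$ is the set of all sets of edges of $E$ adjacent to $i$, and $\Theta=\prod_{i\in V\cup\{s\}}\Theta_i$. A report profile $\theta'\in\Theta$ induces the graph $G_{\theta'}=\langle V\cup\{s\},E_{\theta'}\rangle$ with $E_{\theta'}=\{(i,j)\in E : (i,j)\in\theta_i'\cap\theta_j'\}$. A cost sharing mechanism $(g,f,x)$ assigns to each $\theta'\in\Theta$ a set $g(\theta')\subseteq V$ of selected (connected) nodes, a set $f(\theta')\subseteq E_{\theta'}$ of selected edges connecting the nodes of $g(\theta')$ (to the source), and cost shares $x_i(\theta')\in\mathbb{R}$ for $i\in V$, with $x_i(\theta')=0$ if $i\notin g(\theta')$. Selection function $g^*(\theta',S)$,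 for $\theta'\in\Theta$ and $S\subseteq V$: start with $N=\{s\}$ and $\hat E=\{(p,q)\in E_{\theta'}: p\in N, q\in S\}$. While $\hat E\ne\emptyset$: take an edge $(i,j)\in\hat E$ of smallest cost, with $i\in N$, $j\in S\setminus N$; if $B_j\ge c_{(i,j)}$, replace $N$ by $N\cup\{j\}$ and reset $\hat E=\{(p,q)\in E_{\theta'}: p\in N, q\in S\setminus N\}$; otherwise delete $(i,j)$ from $\hat E$. Output $g^*(\theta',S)=N\setminus\{s\}$. SCSM. Given $\theta'\in\Theta$, set $g(\theta')=g^*(\theta',V)$. For each $S\subseteq g(\theta')$ let $S'=g^*(\theta',S)$ and $v(S)=\sum_{i\in S'}B_i-C(S')$, where $C(S')$ is the minimal cost of connecting $S'$ to $s$ using only nodes of $S'\cup\{s\}$, i.e. the cost of a minimum spanning tree of the subgraph of $G_{\theta'}$ induced by $S'\cup\{s\}$. For $i\in g(\theta')$ let $$\phi_i=\sum_{S\subseteq g(\theta')\setminus\{i\}}\frac{|S|!\,(|g(\theta')|-|S|-1)!}{|g(\theta')|!}\,\bigl(v(S\cup\{i\})-v(S)\bigr),\qquad x_i(\theta')=B_i-\phi_i,$$ and $x_i(\theta')=0$ for $i\in V\setminus g(\theta')$. Finally $f(\theta')$ is the edge set of a minimum spanning tree of the subgraph of $G_{\theta'}$ induced by $g(\theta')\cup\{s\}$. *)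

theory Defs
  imports Complex_Main "HOL-Library.FuncSet"
begin

section \<open>The network and the reports\<close>

text \<open>Edges are unordered pairs \<open>{p, q}\<close> of distinct vertices.\<close>

locale network =
  fixes V :: "'a set" and s :: 'a and E :: "'a set set"
    and c :: "'a set \<Rightarrow> real" and B :: "'a \<Rightarrow> real"
  assumes finite_nodes: "finite V"
    and source: "s \<notin> V"
    and edges: "E \<subseteq> {{p, q} | p q. p \<in> V \<union> {s} \<and> q \<in> V \<union> {s} \<and> p \<noteq> q}"
    and cost_nonneg: "\<And>e. e \<in> E \<Longrightarrow> 0 \<le> c e"
    and budget_pos: "\<And>i. i \<in> V \<Longrightarrow> 0 < B i"

definition report_profiles :: "'a set \<Rightarrow> 'a \<Rightarrow> 'a set set \<Rightarrow> ('a \<Rightarrow> 'a set set) set" where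
  "report_profiles V s E = (\<Pi>\<^sub>E i \<in> V \<union> {s}. Pow {e \<in> E. i \<in> e})"

definition reported_edges :: "'a set set \<Rightarrow> ('a \<Rightarrow> 'a set set) \<Rightarrow> 'a set set" where
  "reported_edges E \<theta> = {{i, j} | i j. {i, j} \<in> E \<and> {i, j} \<in> \<theta> i \<inter> \<theta> j}"

section \<open>Minimum spanning trees\<close>

definition linked :: "'a set set \<Rightarrow> 'a \<Rightarrow> 'a \<Rightarrow> bool" where
  "linked T u v \<longleftrightarrow> (u, v) \<in> {(p, q). {p, q} \<in> T}\<^sup>*"

text \<open>The list holds the vertices of the cycle, without repeating the first one at the end.\<close>

definition is_cycle :: "'a set set \<Rightarrow> 'a list \<Rightarrow> bool" where
  "is_cycle T p \<longleftrightarrow> 3 \<le> length p \<and> distinct p \<and>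
     (\<forall>k < length p. {p ! k, p ! (Suc k mod length p)} \<in> T)"

definition spanning_tree :: "'a set set \<Rightarrow> 'a set \<Rightarrow> 'a set set \<Rightarrow> bool" where
  "spanning_tree F W T \<longleftrightarrow> T \<subseteq> {e \<in> F. e \<subseteq> W} \<and>
     (\<forall>u \<in> W. \<forall>v \<in> W. linked T u v) \<and> (\<nexists>p. is_cycle T p)"

definition min_spanning_tree ::
  "('a set \<Rightarrow> real) \<Rightarrow> 'a set set \<Rightarrow> 'a set \<Rightarrow> 'a set set \<Rightarrow> bool" where
  "min_spanning_tree c F W T \<longleftrightarrow> spanning_tree F W T \<and>
     (\<forall>T'. spanning_tree F W T' \<longrightarrow> sum c T \<le> sum c T')"

definition mst_cost :: "('a set \<Rightarrow> real) \<Rightarrow> 'a set set \<Rightarrow> 'a set \<Rightarrow> real" where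
  "mst_cost c F W = (THE r. \<exists>T. min_spanning_tree c F W T \<and> r = sum c T)"

lemma mst_cost_eq: "min_spanning_tree c F W T \<Longrightarrow> mst_cost c F W = sum c T"
  unfolding mst_cost_def
  by (rule the_equality) (auto simp: min_spanning_tree_def intro: antisym)

section \<open>The selection function\<close>

text \<open>
  A state \<open>(N, X)\<close> of the selection loop consists of the connected vertices \<open>N\<close> and the candidate
  edges \<open>X\<close>, oriented from \<open>N\<close> outwards.  Ties between cheapest candidates are broken arbitrarily,
  so the loop is a relation; the final \<open>N\<close> does not depend on the choices
  (lemma \<open>ex1_selection_output\<close>), which justifies the definite description in \<open>gstar\<close>.
\<close>

definition candidates :: "'a set set \<Rightarrow> 'a set \<Rightarrow> 'a set \<Rightarrow> ('a \<times> 'a) set" where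
  "candidates F N Q = {(p, q). {p, q} \<in> F \<and> p \<in> N \<and> q \<in> Q}"

inductive selection_step ::
  "('a set \<Rightarrow> real) \<Rightarrow> ('a \<Rightarrow> real) \<Rightarrow> 'a set set \<Rightarrow> 'a set \<Rightarrow>
   'a set \<times> ('a \<times> 'a) set \<Rightarrow> 'a set \<times> ('a \<times> 'a) set \<Rightarrow> bool"
  for c B F S where
  accept: "\<lbrakk>(i, j) \<in> X; i \<in> N; j \<in> S - N; \<forall>p q. (p, q) \<in> X \<longrightarrow> c {i, j} \<le> c {p, q}; B j \<ge> c {i, j}\<rbrakk>
    \<Longrightarrow> selection_step c B F S (N, X)
          (N \<union> {j}, candidates F (N \<union> {j}) (S - (N \<union> {j})))"
| reject: "\<lbrakk>(i, j) \<in> X; i \<in> N; j \<in> S - N; \<forall>p q. (p, q) \<in> X \<longrightarrow> c {i, j} \<le> c {p, q}; \<not> B j \<ge> c {i, j}\<rbrakk>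
    \<Longrightarrow> selection_step c B F S (N, X) (N, X - {(i, j)})"

definition selection_output ::
  "('a set \<Rightarrow> real) \<Rightarrow> ('a \<Rightarrow> real) \<Rightarrow> 'a \<Rightarrow> 'a set set \<Rightarrow> 'a set \<Rightarrow> 'a set \<Rightarrow> bool" where
  "selection_output c B s F S A \<longleftrightarrow>
     (\<exists>N. (selection_step c B F S)\<^sup>*\<^sup>* ({s}, candidates F {s} S) (N, {}) \<and> A = N - {s})"

definition gstar ::
  "('a set \<Rightarrow> real) \<Rightarrow> ('a \<Rightarrow> real) \<Rightarrow> 'a \<Rightarrow> 'a set set \<Rightarrow> 'a set \<Rightarrow> 'a set" where
  "gstar c B s F S = (THE A. selection_output c B s F S A)"

section \<open>The saving-based cost sharing mechanism\<close>

definition saving ::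
  "('a set \<Rightarrow> real) \<Rightarrow> ('a \<Rightarrow> real) \<Rightarrow> 'a \<Rightarrow> 'a set set \<Rightarrow> 'a set \<Rightarrow> real" where
  "saving c B s F S =
     (let S' = gstar c B s F S in (\<Sum>i\<in>S'. B i) - mst_cost c F (S' \<union> {s}))"

definition shapley_value :: "'a set \<Rightarrow> ('a set \<Rightarrow> real) \<Rightarrow> 'a \<Rightarrow> real" where
  "shapley_value P v i = (\<Sum>S \<in> Pow (P - {i}).
     fact (card S) * fact (card P - card S - 1) / fact (card P) * (v (S \<union> {i}) - v S))"

text \<open>
  A mechanism is a triple of functions of the report profile: selected nodes, selected edges and
  cost shares.  Since minimum spanning trees need not be unique, being the saving-based mechanism
  is a predicate that leaves their choice open.
\<close>

definition cost_sharing_mechanism ::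
  "'a set \<Rightarrow> 'a \<Rightarrow> 'a set set \<Rightarrow>
   (('a \<Rightarrow> 'a set set) \<Rightarrow> 'a set) \<Rightarrow> (('a \<Rightarrow> 'a set set) \<Rightarrow> 'a set set) \<Rightarrow>
   (('a \<Rightarrow> 'a set set) \<Rightarrow> 'a \<Rightarrow> real) \<Rightarrow> bool" where
  "cost_sharing_mechanism V s E g f x \<longleftrightarrow>
     (\<forall>\<theta> \<in> report_profiles V s E.
        g \<theta> \<subseteq> V \<and> f \<theta> \<subseteq> reported_edges E \<theta> \<and> (\<forall>i \<in> g \<theta>. linked (f \<theta>) i s) \<and>
        (\<forall>i \<in> V - g \<theta>. x \<theta> i = 0))"

definition scsm ::
  "'a set \<Rightarrow> 'a \<Rightarrow> 'a set set \<Rightarrow> ('a set \<Rightarrow> real) \<Rightarrow> ('a \<Rightarrow> real) \<Rightarrow>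
   (('a \<Rightarrow> 'a set set) \<Rightarrow> 'a set) \<Rightarrow> (('a \<Rightarrow> 'a set set) \<Rightarrow> 'a set set) \<Rightarrow>
   (('a \<Rightarrow> 'a set set) \<Rightarrow> 'a \<Rightarrow> real) \<Rightarrow> bool" where
  "scsm V s E c B g f x \<longleftrightarrow> cost_sharing_mechanism V s E g f x \<and>
     (\<forall>\<theta> \<in> report_profiles V s E. let F = reported_edges E \<theta> in
        g \<theta> = gstar c B s F V \<and>
        min_spanning_tree c F (g \<theta> \<union> {s}) (f \<theta>) \<and>
        (\<forall>i \<in> g \<theta>. x \<theta> i = B i - shapley_value (g \<theta>) (saving c B s F) i))"

section \<open>Well-definedness\<close>

lemma spanning_tree_insert:
  assumes T: "spanning_tree F W T" and W: "p \<in> W" "q \<notin> W" and pq: "{p, q} \<in> F"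
  shows "spanning_tree F (W \<union> {q}) (insert {p, q} T)"
proof -
  let ?T = "insert {p, q} T"
  have only: "v = p" if "{q, v} \<in> ?T \<or> {v, q} \<in> ?T" for v
    using that T W by (auto simp: spanning_tree_def doubleton_eq_iff)
  have mono: "linked ?T u v" if "linked T u v" for u v
    using that unfolding linked_def by (rule rtrancl_mono[THEN subsetD, rotated]) auto
  have pW: "linked ?T u p" "linked ?T p u" if "u \<in> W" for u
    using that T W(1) mono by (auto simp: spanning_tree_def)
  have "linked ?T p q" "linked ?T q p"
    unfolding linked_def by (auto simp: insert_commute intro!: r_into_rtrancl)
  with pW have p: "linked ?T u p" "linked ?T p u" if "u \<in> W \<union> {q}" for u
    using that by auto
  have conn: "linked ?T u v" if "u \<in> W \<union> {q}" "v \<in> W \<union> {q}" for u v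
    using p[OF that(1)] p[OF that(2)] unfolding linked_def by (meson rtrancl_trans)
  have "\<not> is_cycle ?T r" for r
  proof
    assume r: "is_cycle ?T r"
    let ?n = "length r"
    have n: "3 \<le> ?n" "distinct r"
      and e: "\<And>k. k < ?n \<Longrightarrow> {r ! k, r ! (Suc k mod ?n)} \<in> ?T"
      using r by (auto simp: is_cycle_def)
    show False
    proof (cases "q \<in> set r")
      case True
      then obtain k where k: "k < ?n" "r ! k = q" by (auto simp: in_set_conv_nth)
      define l where "l = (if k = 0 then ?n - 1 else k - 1)"
      have l: "l < ?n" "Suc l mod ?n = k" using k n by (auto simp: l_def)
      define m where "m = Suc k mod ?n"
      have m: "m < ?n" "m = (if Suc k = ?n then 0 else Suc k)"
        using k(1) by (auto simp: m_def mod_Suc)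
      have "r ! m = p" using e[OF k(1)] k(2) m_def by (intro only) metis
      moreover have "r ! l = p" using e[OF l(1)] k(2) l(2) by (intro only) metis
      ultimately have "m = l" using n l(1) m(1) by (metis nth_eq_iff_index_eq)
      then show False using m(2) k n unfolding l_def by (auto split: if_splits)
    next
      case False
      have "{r ! k, r ! (Suc k mod ?n)} \<in> T" if k: "k < ?n" for k
      proof -
        have "Suc k mod ?n < ?n" using k by (intro mod_less_divisor) auto
        then have "q \<noteq> r ! k" "q \<noteq> r ! (Suc k mod ?n)" using False k by (metis nth_mem)+
        then show ?thesis using e[OF k] by auto
      qed
      then have "is_cycle T r" using n by (simp add: is_cycle_def)
      then show False using T by (simp add: spanning_tree_def)
    qed
  qed
  then show ?thesis
    using T W pq conn by (auto simp: spanning_tree_def)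
qed

lemma ex_min_spanning_tree:
  assumes "finite F" and "spanning_tree F W T"
  shows "\<exists>T. min_spanning_tree c F W T"
proof -
  let ?A = "{T. spanning_tree F W T}"
  have "?A \<subseteq> Pow F" by (auto simp: spanning_tree_def)
  then have fin: "finite ?A" using assms(1) by (meson finite_Pow_iff finite_subset)
  have ne: "?A \<noteq> {}" using assms(2) by auto
  have "min_spanning_tree c F W (arg_min_on (sum c) ?A)"
    using arg_min_if_finite(1)[OF fin ne, of "sum c"] arg_min_least[OF fin ne, of _ "sum c"]
    by (auto simp: min_spanning_tree_def)
  then show ?thesis ..
qed

text \<open>At termination the invariant pins down \<open>N\<close>, and \<open>N\<close> has a spanning tree.\<close>

lemma selection_invariant:
  assumes "(selection_step c B F S)\<^sup>*\<^sup>* ({s}, candidates F {s} S) (N, X)" and "s \<notin> S"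
  shows "s \<in> N" "N \<subseteq> insert s S" "X \<subseteq> candidates F N (S - N)"
    "\<And>p q. (p, q) \<in> candidates F N (S - N) \<Longrightarrow> (p, q) \<notin> X \<Longrightarrow> B q < c {p, q}"
    "\<And>M. s \<in> M \<Longrightarrow> (\<And>p q. (p, q) \<in> candidates F M (S - M) \<Longrightarrow> B q < c {p, q}) \<Longrightarrow> N \<subseteq> M"
    "\<exists>T. spanning_tree F N T"
proof -
  have "s \<in> N \<and> N \<subseteq> insert s S \<and> X \<subseteq> candidates F N (S - N) \<and>
    (\<forall>p q. (p, q) \<in> candidates F N (S - N) \<longrightarrow> (p, q) \<notin> X \<longrightarrow> B q < c {p, q}) \<and>
    (\<forall>M. s \<in> M \<longrightarrow> (\<forall>p q. (p, q) \<in> candidates F M (S - M) \<longrightarrow> B q < c {p, q}) \<longrightarrow> N \<subseteq> M) \<and>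
    (\<exists>T. spanning_tree F N T)"
    using assms(1)
  proof (induction rule: rtranclp_induct2)
    case refl
    have "\<not> is_cycle {} p" for p :: "'a list"
      by (cases p) (auto simp: is_cycle_def)
    then have "spanning_tree F {s} {}"
      by (simp add: spanning_tree_def linked_def)
    then have "\<exists>T. spanning_tree F {s} T" by (rule exI)
    moreover have "candidates F {s} (S - {s}) = candidates F {s} S" using assms(2) by simp
    ultimately show ?case by simp
  next
    case (step N X N' X')
    have sN: "s \<in> N" "N \<subseteq> insert s S" and X: "X \<subseteq> candidates F N (S - N)"
      and rejected: "\<And>p q. (p, q) \<in> candidates F N (S - N) \<Longrightarrow> (p, q) \<notin> X \<Longrightarrow> B q < c {p, q}"
      and least: "\<And>M. s \<in> M \<Longrightarrow> \<forall>p q. (p, q) \<in> candidates F M (S - M) \<longrightarrow> B q < c {p, q} \<Longrightarrow> N \<subseteq> M"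
      using step.IH by auto
    from step(2) show ?case
    proof cases
      case (accept i j)
      have ij: "{i, j} \<in> F" "i \<in> N" "j \<in> S" "j \<notin> N"
        using X accept(3-5) by (auto simp: candidates_def)
      have "N' \<subseteq> M" if M: "s \<in> M" "\<forall>p q. (p, q) \<in> candidates F M (S - M) \<longrightarrow> B q < c {p, q}" for M
      proof -
        have "N \<subseteq> M" using least M by blast
        moreover have "j \<in> M"
        proof (rule ccontr)
          assume "j \<notin> M"
          then have "(i, j) \<in> candidates F M (S - M)"
            using \<open>N \<subseteq> M\<close> ij by (auto simp: candidates_def)
          then have "B j < c {i, j}" using M(2) by blast
          then show False using accept(7) by simp
        qed
        ultimately show ?thesis using accept(1) by simp
      qed
      moreover obtain T where T: "spanning_tree F N T" using step.IH by (elim conjE exE)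
      have "\<exists>T. spanning_tree F N' T"
        using spanning_tree_insert[OF T ij(2,4,1)] unfolding accept(1) by (rule exI)
      moreover have "s \<in> N'" "N' \<subseteq> insert s S" using sN ij accept(1) by auto
      ultimately show ?thesis using accept(1,2) by simp
    next
      case (reject i j)
      have "B q < c {p, q}" if "(p, q) \<in> candidates F N (S - N)" "(p, q) \<notin> X'" for p q
        using that rejected[of p q] reject(2,7) by (cases "(p, q) = (i, j)") auto
      moreover have "X' \<subseteq> candidates F N (S - N)" using X reject(2) by auto
      ultimately show ?thesis using step.IH reject(1) by simp
    qed
  qed
  then show "s \<in> N" "N \<subseteq> insert s S" "X \<subseteq> candidates F N (S - N)"
    "\<And>p q. (p, q) \<in> candidates F N (S - N) \<Longrightarrow> (p, q) \<notin> X \<Longrightarrow> B q < c {p, q}"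
    "\<And>M. s \<in> M \<Longrightarrow> (\<And>p q. (p, q) \<in> candidates F M (S - M) \<Longrightarrow> B q < c {p, q}) \<Longrightarrow> N \<subseteq> M"
    "\<exists>T. spanning_tree F N T"
    by simp_all
qed

lemma selection_terminates:
  assumes "finite S" and "X \<subseteq> candidates F N (S - N)" and "finite N"
  shows "\<exists>N'. (selection_step c B F S)\<^sup>*\<^sup>* (N, X) (N', {})"
  using assms
proof (induction "(card (S - N), card X)" arbitrary: N X
    rule: wf_induct_rule[OF wf_lex_prod[OF wf_less_than wf_less_than]])
  case (1 N X)
  have "X \<subseteq> N \<times> S" using 1(3) by (auto simp: candidates_def)
  then have finX: "finite X" using 1(2,4) by (meson finite_SigmaI finite_subset)
  show ?case
  proof (cases "X = {}")
    case False
    define w where "w = (\<lambda>(p, q). c {p, q})"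
    obtain i j where ij: "arg_min_on w X = (i, j)" by (cases "arg_min_on w X")
    have mX: "(i, j) \<in> X" using arg_min_if_finite(1)[OF finX False, of w] ij by simp
    have mmin: "\<forall>p q. (p, q) \<in> X \<longrightarrow> c {i, j} \<le> c {p, q}"
      using arg_min_least[OF finX False, of _ w] ij by (auto simp: w_def)
    have inN: "i \<in> N" "j \<in> S - N" using mX 1(3) by (auto simp: candidates_def)
    show ?thesis
    proof (cases "B j \<ge> c {i, j}")
      case True
      let ?N = "N \<union> {j}" and ?X = "candidates F (N \<union> {j}) (S - (N \<union> {j}))"
      have "card (S - ?N) < card (S - N)"
        using inN 1(2) by (intro psubset_card_mono) auto
      then obtain N' where "(selection_step c B F S)\<^sup>*\<^sup>* (?N, ?X) (N', {})"
        using 1(1)[of ?N ?X] 1(2,4) by auto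
      moreover have "selection_step c B F S (N, X) (?N, ?X)"
        by (rule selection_step.accept[where i = i]) (use mX inN mmin True in auto)
      ultimately show ?thesis
        by (meson converse_rtranclp_into_rtranclp)
    next
      case False
      have "card (X - {(i, j)}) < card X" using mX finX by (metis card_Diff1_less)
      moreover have "X - {(i, j)} \<subseteq> candidates F N (S - N)" using 1(3) by auto
      ultimately obtain N' where "(selection_step c B F S)\<^sup>*\<^sup>* (N, X - {(i, j)}) (N', {})"
        using 1(1)[of N "X - {(i, j)}"] 1(2,4) by auto
      moreover have "selection_step c B F S (N, X) (N, X - {(i, j)})"
        by (rule selection_step.reject) (use mX inN mmin False in auto)
      ultimately show ?thesis
        by (meson converse_rtranclp_into_rtranclp)
    qed
  qed auto
qed

lemma ex1_selection_output:
  assumes "finite S" and "s \<notin> S"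
  shows "\<exists>!A. selection_output c B s F S A"
proof -
  have "\<exists>N. (selection_step c B F S)\<^sup>*\<^sup>* ({s}, candidates F {s} S) (N, {})"
    using assms by (intro selection_terminates) (auto simp: candidates_def)
  moreover have "N \<subseteq> N'"
    if N: "(selection_step c B F S)\<^sup>*\<^sup>* ({s}, candidates F {s} S) (N, {})"
      and N': "(selection_step c B F S)\<^sup>*\<^sup>* ({s}, candidates F {s} S) (N', {})" for N N'
    using selection_invariant(1,4)[OF N' assms(2)] by (intro selection_invariant(5)[OF N assms(2)]) auto
  ultimately show ?thesis unfolding selection_output_def by (metis subset_antisym)
qed

lemma selection_output_gstar:
  assumes "finite S" and "s \<notin> S"
  shows "selection_output c B s F S (gstar c B s F S)"
  unfolding gstar_def by (rule theI') (rule ex1_selection_output[OF assms])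

lemma gstar_spanning:
  assumes "finite S" and "s \<notin> S"
  shows "gstar c B s F S \<subseteq> S" and "\<exists>T. spanning_tree F (gstar c B s F S \<union> {s}) T"
proof -
  obtain N where N: "(selection_step c B F S)\<^sup>*\<^sup>* ({s}, candidates F {s} S) (N, {})"
    and A: "gstar c B s F S = N - {s}"
    using selection_output_gstar[OF assms] unfolding selection_output_def by blast
  have "N - {s} \<union> {s} = N" using selection_invariant(1)[OF N assms(2)] by auto
  with A show "\<exists>T. spanning_tree F (gstar c B s F S \<union> {s}) T"
    using selection_invariant(6)[OF N assms(2)] by simp
  show "gstar c B s F S \<subseteq> S"
    using A selection_invariant(2)[OF N assms(2)] by auto
qed

lemma (in network) ex_scsm: "\<exists>g f x. scsm V s E c B g f x"
proof -
  have "E \<subseteq> Pow (V \<union> {s})" using edges by auto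
  then have "finite E" using finite_nodes by (meson finite_Pow_iff finite.intros finite_UnI finite_subset)
  then have fin: "finite (reported_edges E \<theta>)" for \<theta>
    by (rule rev_finite_subset) (auto simp: reported_edges_def)
  define g where "g = (\<lambda>\<theta>. gstar c B s (reported_edges E \<theta>) V)"
  have gV: "g \<theta> \<subseteq> V" for \<theta>
    using gstar_spanning(1)[OF finite_nodes source] by (simp add: g_def)
  have "\<forall>\<theta>. \<exists>T. min_spanning_tree c (reported_edges E \<theta>) (g \<theta> \<union> {s}) T"
    using gstar_spanning(2)[OF finite_nodes source] ex_min_spanning_tree[OF fin]
    unfolding g_def by blast
  then obtain f where f: "\<And>\<theta>. min_spanning_tree c (reported_edges E \<theta>) (g \<theta> \<union> {s}) (f \<theta>)"
    by metis
  define x where "x = (\<lambda>\<theta> i. if i \<in> g \<theta>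
    then B i - shapley_value (g \<theta>) (saving c B s (reported_edges E \<theta>)) i else 0)"
  have fE: "f \<theta> \<subseteq> reported_edges E \<theta>" and conn: "\<forall>i \<in> g \<theta>. linked (f \<theta>) i s" for \<theta>
    using f[of \<theta>] unfolding min_spanning_tree_def spanning_tree_def by blast+
  have "cost_sharing_mechanism V s E g f x"
    using gV fE conn by (simp add: cost_sharing_mechanism_def x_def)
  then have "scsm V s E c B g f x"
    using f by (simp add: scsm_def x_def g_def)
  then show ?thesis by blast
qed

end

theory Submission
  imports Defs
begin

text \<open>
  The selected set \<open>gstar S\<close> is the set of nodes reachable from the source inside \<open>S\<close> along arcs
  \<open>(p, q)\<close> with \<open>c {p, q} \<le> B q\<close>.  Hence unselected nodes are null players of the saving game, and the
  Shapley value may be taken over all nodes both before and after the increase.  Raising the cost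
  of an edge at \<open>i\<close> does not change the savings of coalitions without \<open>i\<close>.  It cannot increase those
  of coalitions with \<open>i\<close>: a spanning tree of the shrunken selected set extends to the nodes that
  were lost along affordable arcs, so reconnecting them costs at most their budgets.
\<close>

section \<open>Selected sets as least closed sets\<close>

lemma gstar_closed:
  assumes "finite S" "s \<notin> S" "{p, q} \<in> F"
    and "p \<in> insert s (gstar c B s F S)" "q \<in> S - gstar c B s F S"
  shows "B q < c {p, q}"
proof -
  obtain N where N: "(selection_step c B F S)\<^sup>*\<^sup>* ({s}, candidates F {s} S) (N, {})"
    and A: "gstar c B s F S = N - {s}"
    using selection_output_gstar[OF assms(1,2)] unfolding selection_output_def by blast
  have "(p, q) \<in> candidates F N (S - N)"
    using assms A selection_invariant(1)[OF N assms(2)] by (auto simp: candidates_def)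
  then show ?thesis using selection_invariant(4)[OF N assms(2)] by blast
qed

text \<open>Together with \<open>gstar_closed\<close> this describes \<open>gstar\<close> without
  the selection loop: it is the least set from which, together with the source, no affordable arc
  leads to another node of \<open>S\<close>.\<close>

lemma gstar_least:
  assumes "finite S" "s \<notin> S"
    and "\<And>p q. {p, q} \<in> F \<Longrightarrow> p \<in> insert s A \<Longrightarrow> q \<in> S - A \<Longrightarrow> B q < c {p, q}"
  shows "gstar c B s F S \<subseteq> A"
proof -
  obtain N where N: "(selection_step c B F S)\<^sup>*\<^sup>* ({s}, candidates F {s} S) (N, {})"
    and A: "gstar c B s F S = N - {s}"
    using selection_output_gstar[OF assms(1,2)] unfolding selection_output_def by blast
  have "N \<subseteq> insert s A"
    by (rule selection_invariant(5)[OF N assms(2)]) (use assms(3) in \<open>auto simp: candidates_def\<close>)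
  then show ?thesis using A by auto
qed

lemma gstar_subset: "finite S \<Longrightarrow> s \<notin> S \<Longrightarrow> gstar c B s F S \<subseteq> S"
  by (rule gstar_spanning(1))

lemma gstar_mono:
  assumes "finite S'" "s \<notin> S'" "S \<subseteq> S'"
  shows "gstar c B s F S \<subseteq> gstar c B s F S'"
proof (rule gstar_least)
  show "finite S" "s \<notin> S" using assms finite_subset by auto
  show "B q < c {p, q}"
    if "{p, q} \<in> F" "p \<in> insert s (gstar c B s F S')" "q \<in> S - gstar c B s F S'" for p q
    using gstar_closed[OF assms(1,2) that(1,2)] that(3) assms(3) by blast
qed

text \<open>Raising costs only removes affordable arcs, so a set closed for \<open>c\<close> stays
  closed for \<open>c'\<close>. Only edges inside \<open>S \<union> {s}\<close> matter; for costs
  that agree there, \<open>saving_cong\<close> uses the inclusion in both directions.\<close>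

lemma gstar_antimono_cost:
  assumes "finite S" "s \<notin> S" "\<And>e. e \<in> F \<Longrightarrow> e \<subseteq> S \<union> {s} \<Longrightarrow> c e \<le> c' e"
  shows "gstar c' B s F S \<subseteq> gstar c B s F S"
proof (rule gstar_least[OF assms(1,2)])
  fix p q
  assume pq: "{p, q} \<in> F" "p \<in> insert s (gstar c B s F S)" "q \<in> S - gstar c B s F S"
  have "{p, q} \<subseteq> S \<union> {s}"
    using pq gstar_subset[OF assms(1,2)] by blast
  then show "B q < c' {p, q}"
    using gstar_closed[OF assms(1,2) pq] assms(3)[OF pq(1)] by fastforce
qed

text \<open>Nodes of \<open>S\<close> outside \<open>gstar c B s F V\<close> cannot be reached
  affordably even with all of \<open>V\<close> available, so dropping them from the coalition loses
  no path.\<close>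

lemma gstar_Int_gstar:
  assumes "finite V" "s \<notin> V" "S \<subseteq> V"
  shows "gstar c B s F (S \<inter> gstar c B s F V) = gstar c B s F S"
proof
  let ?g = "gstar c B s F"
  have fin: "finite S" "s \<notin> S" "finite (S \<inter> ?g V)" "s \<notin> S \<inter> ?g V"
    using assms finite_subset by auto
  show "?g (S \<inter> ?g V) \<subseteq> ?g S" using fin by (intro gstar_mono) auto
  show "?g S \<subseteq> ?g (S \<inter> ?g V)"
  proof (rule gstar_least[OF fin(1,2)])
    fix p q
    assume pq: "{p, q} \<in> F" "p \<in> insert s (?g (S \<inter> ?g V))" "q \<in> S - ?g (S \<inter> ?g V)"
    show "B q < c {p, q}"
    proof (cases "q \<in> ?g V")
      case True
      then show ?thesis using gstar_closed[OF fin(3,4) pq(1,2)] pq(3) by blast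
    next
      case False
      have "p \<in> insert s (?g V)" using pq(2) gstar_subset[OF fin(3,4)] by blast
      then show ?thesis using gstar_closed[OF assms(1,2) pq(1)] pq(3) False assms(3) by blast
    qed
  qed
qed

section \<open>Savings of coalitions\<close>

lemma saving_Int_gstar:
  assumes "finite V" "s \<notin> V" "S \<subseteq> V"
  shows "saving c B s F (S \<inter> gstar c B s F V) = saving c B s F S"
  by (simp add: saving_def gstar_Int_gstar[OF assms])

lemma mst_cost_cong:
  assumes "\<And>e. e \<in> F \<Longrightarrow> e \<subseteq> W \<Longrightarrow> c e = c' e"
  shows "mst_cost c F W = mst_cost c' F W"
proof -
  have eq: "sum c T = sum c' T" if "spanning_tree F W T" for T
    using that assms by (intro sum.cong) (auto simp: spanning_tree_def)
  have "min_spanning_tree c F W T \<longleftrightarrow> min_spanning_tree c' F W T" for T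
    using eq by (auto simp: min_spanning_tree_def)
  moreover have "sum c T = sum c' T" if "min_spanning_tree c' F W T" for T
    using that eq by (auto simp: min_spanning_tree_def)
  ultimately show ?thesis unfolding mst_cost_def by (metis (no_types, lifting))
qed

lemma saving_cong:
  assumes "finite S" "s \<notin> S" "\<And>e. e \<in> F \<Longrightarrow> e \<subseteq> S \<union> {s} \<Longrightarrow> c e = c' e"
  shows "saving c B s F S = saving c' B s F S"
proof -
  have g: "gstar c B s F S = gstar c' B s F S"
    using assms by (intro subset_antisym gstar_antimono_cost) auto
  have "gstar c' B s F S \<union> {s} \<subseteq> S \<union> {s}" using gstar_subset[OF assms(1,2)] by blast
  then have "mst_cost c F (gstar c' B s F S \<union> {s}) = mst_cost c' F (gstar c' B s F S \<union> {s})"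
    by (intro mst_cost_cong assms(3)) auto
  then show ?thesis by (simp add: saving_def g)
qed

text \<open>Induction on the number of missing nodes. While some are missing, \<open>A\<close> is
  not closed, so an affordable arc leaves it; attaching its endpoint as a leaf costs at most that
  node's budget.\<close>

lemma spanning_tree_extend_gstar:
  assumes S: "finite S" "s \<notin> S" and F: "finite F"
    and "A \<subseteq> gstar c B s F S" "spanning_tree F (A \<union> {s}) T"
  shows "\<exists>T'. spanning_tree F (gstar c B s F S \<union> {s}) T' \<and>
    sum c T' \<le> sum c T + sum B (gstar c B s F S - A)"
  using assms(4,5)
proof (induction "card (gstar c B s F S - A)" arbitrary: A T rule: less_induct)
  case less
  let ?g = "gstar c B s F S"
  have g: "?g \<subseteq> S" "finite ?g" "s \<notin> ?g"
    using gstar_subset[OF S, of c B F] S finite_subset by auto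
  show ?case
  proof (cases "?g \<subseteq> A")
    case True
    then have "A = ?g" using less.prems(1) by blast
    then show ?thesis using less.prems(2) by auto
  next
    case False
    then obtain p q where pq: "{p, q} \<in> F" "p \<in> insert s A" "q \<in> S - A" "c {p, q} \<le> B q"
      using gstar_least[OF S, of F A B c] by (meson not_le)
    \<comment> \<open>The arc is affordable and starts in \<open>insert s ?g\<close>, so closedness
      of \<open>?g\<close> forces its endpoint into \<open>?g\<close>.\<close>
    have qg: "q \<in> ?g"
      using gstar_closed[OF S pq(1), of c B] pq less.prems(1) by (auto simp: not_less[symmetric])
    have W: "p \<in> A \<union> {s}" "q \<notin> A \<union> {s}" using pq S by auto
    let ?A = "insert q A" and ?T = "insert {p, q} T"
    have T: "spanning_tree F (?A \<union> {s}) ?T"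
      using spanning_tree_insert[OF less.prems(2) W pq(1)] by (simp add: insert_commute)
    have diff: "?g - A = insert q (?g - ?A)" using qg W by auto
    have "card (?g - ?A) < card (?g - A)"
      using g(2) qg W by (intro psubset_card_mono) auto
    then obtain T' where T': "spanning_tree F (?g \<union> {s}) T'"
      "sum c T' \<le> sum c ?T + sum B (?g - ?A)"
      using less.hyps[OF _ _ T] less.prems(1) qg by auto
    have "T \<subseteq> F" "{p, q} \<notin> T" using less.prems(2) W by (auto simp: spanning_tree_def)
    moreover from this have "finite T" using F finite_subset by blast
    ultimately have "sum c ?T = c {p, q} + sum c T" by simp
    moreover have "sum B (?g - A) = B q + sum B (?g - ?A)"
      unfolding diff using g(2) by (subst sum.insert) auto
    ultimately have "sum c T' \<le> sum c T + sum B (?g - A)" using T'(2) pq(4) by linarith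
    then show ?thesis using T'(1) by blast
  qed
qed

lemma saving_antimono_cost:
  assumes S: "finite S" "s \<notin> S" and F: "finite F" and le: "\<And>e. e \<in> F \<Longrightarrow> c e \<le> c' e"
  shows "saving c' B s F S \<le> saving c B s F S"
proof -
  let ?g = "gstar c B s F S" and ?h = "gstar c' B s F S"
  have sub: "?h \<subseteq> ?g" using S le by (intro gstar_antimono_cost) auto
  obtain T where T: "min_spanning_tree c' F (?h \<union> {s}) T"
    using gstar_spanning(2)[OF S] ex_min_spanning_tree[OF F] by blast
  obtain T0 where T0: "min_spanning_tree c F (?g \<union> {s}) T0"
    using gstar_spanning(2)[OF S] ex_min_spanning_tree[OF F] by blast
  have st: "spanning_tree F (?h \<union> {s}) T" using T by (simp add: min_spanning_tree_def)
  \<comment> \<open>The tree grown from \<open>T\<close> bounds the optimum on \<open>?g\<close>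
    from above; the extra cost is covered by the budgets of \<open>?g - ?h\<close>, which
    \<open>?g\<close> collects and \<open>?h\<close> does not.\<close>
  obtain T' where T': "spanning_tree F (?g \<union> {s}) T'" "sum c T' \<le> sum c T + sum B (?g - ?h)"
    using spanning_tree_extend_gstar[OF S F sub st] by blast
  have "sum c T0 \<le> sum c T'" using T0 T'(1) by (simp add: min_spanning_tree_def)
  moreover have "sum c T \<le> sum c' T"
    using st le by (intro sum_mono) (auto simp: spanning_tree_def)
  moreover have "finite ?g" using gstar_subset[OF S] S(1) by (rule finite_subset)
  then have "sum B ?g = sum B ?h + sum B (?g - ?h)"
    using sum.subset_diff[OF sub, of B] by simp
  ultimately show ?thesis
    using T'(2) mst_cost_eq[OF T] mst_cost_eq[OF T0] by (simp add: saving_def Let_def)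
qed

section \<open>Shapley values and null players\<close>

text \<open>The right side is the probability that, in a random order of \<open>n\<close> players, a
  given \<open>k\<close>-set is exactly the set of predecessors of a given player outside it. A
  further player comes either after that player or before, which gives the two terms on the
  left.\<close>

lemma shapley_weight_split:
  assumes "k < n"
  shows "fact k * fact (Suc n - k - 1) / fact (Suc n)
      + fact (Suc k) * fact (Suc n - Suc k - 1) / fact (Suc n)
    = (fact k * fact (n - k - 1) / fact n :: real)"
proof -
  \<comment> \<open>This form of \<open>n\<close> removes the truncated subtractions.\<close>
  obtain m where "n = Suc (k + m)" using assms less_imp_Suc_add by blast
  then show ?thesis by (simp add: divide_simps) (simp add: algebra_simps)
qed

text \<open>Coalitions pair up as \<open>S\<close> and \<open>insert k S\<close>, with the same
  marginal contribution of \<open>i\<close>; the weights of a pair add up to the weight of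
  \<open>S\<close> among the players \<open>P\<close>.\<close>

lemma shapley_value_insert_null:
  assumes P: "finite P" "i \<in> P" "k \<notin> P" and null: "\<And>S. S \<subseteq> P \<Longrightarrow> v (insert k S) = v S"
  shows "shapley_value (insert k P) v i = shapley_value P v i"
proof -
  let ?Q = "P - {i}"
  define w :: "nat \<Rightarrow> nat \<Rightarrow> real" where "w n m = fact m * fact (n - m - 1) / fact n" for n m
  define d where "d S = v (S \<union> {i}) - v S" for S
  have sv: "shapley_value R v i = (\<Sum>S \<in> Pow (R - {i}). w (card R) (card S) * d S)" for R
    by (simp add: shapley_value_def w_def d_def)
  have Q: "insert k P - {i} = insert k ?Q" "k \<notin> ?Q" "finite ?Q" using P by auto
  have card: "card (insert k S) = Suc (card S)" if "S \<in> Pow ?Q" for S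
    using that P finite_subset[OF _ P(1)] by (subst card_insert_disjoint) auto
  have dk: "d (insert k S) = d S" if "S \<in> Pow ?Q" for S
  proof -
    have "insert i S \<subseteq> P" "S \<subseteq> P" using that P by auto
    then show ?thesis using null[of S] null[of "insert i S"] by (simp add: d_def insert_commute)
  qed
  have lt: "card S < card P" if "S \<in> Pow ?Q" for S
    using that P by (intro psubset_card_mono) auto
  let ?n = "Suc (card P)"
  have "shapley_value (insert k P) v i = (\<Sum>S \<in> Pow (insert k ?Q). w ?n (card S) * d S)"
    unfolding sv Q(1) using P by simp
  also have "\<dots> = (\<Sum>S \<in> Pow ?Q. w ?n (card S) * d S) + (\<Sum>S \<in> insert k ` Pow ?Q. w ?n (card S) * d S)"
    unfolding Pow_insert using Q by (intro sum.union_disjoint) auto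
  also have "(\<Sum>S \<in> insert k ` Pow ?Q. w ?n (card S) * d S)
      = (\<Sum>S \<in> Pow ?Q. w ?n (Suc (card S)) * d S)"
  proof (subst sum.reindex)
    show "inj_on (insert k) (Pow ?Q)" using Q(2) by (auto simp: inj_on_def insert_ident)
  qed (use card dk in \<open>auto intro!: sum.cong\<close>)
  also have "(\<Sum>S \<in> Pow ?Q. w ?n (card S) * d S) + \<dots>
      = (\<Sum>S \<in> Pow ?Q. (w ?n (card S) + w ?n (Suc (card S))) * d S)"
    by (simp add: sum.distrib distrib_right)
  also have "\<dots> = (\<Sum>S \<in> Pow ?Q. w (card P) (card S) * d S)"
    using lt shapley_weight_split by (intro sum.cong) (auto simp: w_def)
  finally show ?thesis by (simp add: sv)
qed

text \<open>The players of \<open>Q - P\<close> are added one at a time; each is null because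
  \<open>v\<close> sees only \<open>S \<inter> P\<close>.\<close>

lemma shapley_value_carrier:
  assumes "finite Q" "P \<subseteq> Q" "i \<in> P" and carrier: "\<And>S. S \<subseteq> Q \<Longrightarrow> v (S \<inter> P) = v S"
  shows "shapley_value P v i = shapley_value Q v i"
proof -
  have "shapley_value (P \<union> R) v i = shapley_value P v i" if "R \<subseteq> Q - P" for R
    using finite_subset[OF that finite_Diff[OF assms(1)]] that
  proof (induction R rule: finite_induct)
    case (insert k R)
    have "v (insert k S) = v S" if "S \<subseteq> P \<union> R" for S
    proof -
      have "insert k S \<subseteq> Q" "S \<subseteq> Q" "insert k S \<inter> P = S \<inter> P"
        using that insert.prems assms(2) by auto
      then show ?thesis using carrier by metis
    qed
    moreover have "finite (P \<union> R)" using assms(1,2) insert.hyps finite_subset by auto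
    ultimately have "shapley_value (insert k (P \<union> R)) v i = shapley_value (P \<union> R) v i"
      using insert assms(3) by (intro shapley_value_insert_null) auto
    then show ?case using insert by simp
  qed simp
  from this[of "Q - P"] show ?thesis using assms(2) by (simp add: Un_absorb1)
qed

lemma shapley_value_mono:
  assumes "\<And>S. S \<subseteq> P - {i} \<Longrightarrow> v (S \<union> {i}) - v S \<le> u (S \<union> {i}) - u S"
  shows "shapley_value P v i \<le> shapley_value P u i"
  unfolding shapley_value_def using assms by (intro sum_mono mult_left_mono) auto

section \<open>Cost shares before and after the increase\<close>

text \<open>Replacing \<open>g \<theta>\<close> by \<open>V\<close> puts the games for both cost
  functions on one player set, although the selected sets may differ; their Shapley values can then
  be compared term by term.\<close>

lemma scsm_cost_share:
  assumes "finite V" "s \<notin> V" "scsm V s E c B g f x" "\<theta> \<in> report_profiles V s E" "i \<in> g \<theta>"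
  shows "x \<theta> i = B i - shapley_value V (saving c B s (reported_edges E \<theta>)) i"
proof -
  let ?F = "reported_edges E \<theta>"
  have g: "g \<theta> = gstar c B s ?F V"
    and x: "x \<theta> i = B i - shapley_value (g \<theta>) (saving c B s ?F) i"
    using assms(3-5) by (auto simp: scsm_def Let_def)
  have "shapley_value (g \<theta>) (saving c B s ?F) i = shapley_value V (saving c B s ?F) i"
    using assms(1,2,5) g gstar_subset[OF assms(1,2)] saving_Int_gstar[OF assms(1,2)]
    by (intro shapley_value_carrier) auto
  with x show ?thesis by simp
qed

lemma (in network) finite_reported_edges: "finite (reported_edges E \<theta>)"
proof (rule finite_subset)
  have "E \<subseteq> Pow (V \<union> {s})" using edges by auto
  moreover have "reported_edges E \<theta> \<subseteq> E" by (auto simp: reported_edges_def)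
  ultimately show "reported_edges E \<theta> \<subseteq> Pow (V \<union> {s})" by (rule subset_trans[rotated])
  show "finite (Pow (V \<union> {s}))" using finite_nodes by simp
qed

theorem theorem5p6:
  fixes V :: "'a set" and s :: 'a and E :: "'a set set"
    and c :: "'a set \<Rightarrow> real" and B :: "'a \<Rightarrow> real"
    and g g' :: "('a \<Rightarrow> 'a set set) \<Rightarrow> 'a set"
    and f f' :: "('a \<Rightarrow> 'a set set) \<Rightarrow> 'a set set"
    and x x' :: "('a \<Rightarrow> 'a set set) \<Rightarrow> 'a \<Rightarrow> real"
    and \<theta> :: "'a \<Rightarrow> 'a set set" and i j :: 'a and a :: real
  assumes "network V s E c B"
    and "\<theta> \<in> report_profiles V s E"
    and "{i, j} \<in> \<theta> i"
    and "c {i, j} < a"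
    and "scsm V s E c B g f x"
    and "scsm V s E (c({i, j} := a)) B g' f' x'"
    and "i \<in> g \<theta>"
    and "i \<in> g' \<theta>"
  shows "x \<theta> i \<le> x' \<theta> i"
proof -
  interpret network V s E c B by fact
  let ?c = "c({i, j} := a)" and ?F = "reported_edges E \<theta>"
  have "i \<in> V"
    using assms(2,5,7) by (auto simp: scsm_def cost_sharing_mechanism_def)
  have "shapley_value V (saving ?c B s ?F) i \<le> shapley_value V (saving c B s ?F) i"
  proof (rule shapley_value_mono)
    fix S assume S: "S \<subseteq> V - {i}"
    have fin: "finite S" "s \<notin> S" "finite (S \<union> {i})" "s \<notin> S \<union> {i}" and "i \<notin> S \<union> {s}"
      using S \<open>i \<in> V\<close> source finite_nodes finite_subset by auto
    \<comment> \<open>The modified edge contains \<open>i\<close>, so it does not lie inside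
      \<open>S \<union> {s}\<close>.\<close>
    have "saving ?c B s ?F S = saving c B s ?F S"
      using \<open>i \<notin> S \<union> {s}\<close> by (intro saving_cong[OF fin(1,2)]) auto
    moreover have "saving ?c B s ?F (S \<union> {i}) \<le> saving c B s ?F (S \<union> {i})"
      using assms(4) by (intro saving_antimono_cost[OF fin(3,4) finite_reported_edges]) auto
    ultimately show "saving ?c B s ?F (S \<union> {i}) - saving ?c B s ?F S
        \<le> saving c B s ?F (S \<union> {i}) - saving c B s ?F S" by simp
  qed
  then show ?thesis
    using scsm_cost_share[OF finite_nodes source assms(5,2,7)]
      scsm_cost_share[OF finite_nodes source assms(6,2,8)] by simp
qed

end
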